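(* For every non-atomic measure $\mu$ on $\beta\omega$ there is a tree $\mathcal{T}$ of subsets of $\omega$ such that for every $U\subseteq\omega$ satisfying $T_U\in\mathcal{N}$ we have $\mu([U])=0$. Consequently, if an ultrafilter $\mathcal{U}$ on $\omega$ $\mathcal{N}$-diagonalizes every full tree of subsets of $\omega$, then $\mathcal{U}$ avoids non-atomic measures, i.e. $\mathcal{U}\notin\mathrm{supp}(\nu)$ for every non-atomic measure $\nu$ on $\beta\omega$.
   Context: A measure on a topological space is a $\sigma$-additive Radon probability measure on its Borel sets; it is non-atomic if it vanishes on singletons; its support is the intersection of all closed sets of measure $1$. $\beta\omega$ is the space of ultrafilters on $\omega$, and for $U\subseteq\omega$, $[U]=\{x\in\beta\omega: U\in x\}$. For $A,B\subseteq\omega$ write $A\subseteq^\ast B$ if $A\setminus B$ is finite and $A=^\ast B$ if $A\triangle B$ is finite. A tree of subsets of $\omega$ is a family $\mathcal{T}=\{T_s: s\in 2^{<\omega}\}$ with $T_s\subseteq\omega$ such that: if $s$ extends $t$ then $T_s\subseteq^\ast T_t$; and for every $k\in\omega$, $\bigcup\{T_s: s\in 2^k\}=^\ast\omega$ and $T_s\cap T_t=^\ast\emptyset$ for distinct $s,t\in 2^k$ (the $T_s$ may be empty). The tree is full if every $T_s$ is infinite. For $X\subseteq\omega$ let $T_X=\{x\in 2^\omega: \forall k\ T_{x|k}\cap X \text{ is infinite}\}$. $\mathcal{N}$ is the $\sigma$-ideal of Lebesgue (Haar) measure zero subsets of $2^\omega$. An ultrafilter $\mathcal{U}$ on $\omega$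 $\mathcal{N}$-diagonalizes a tree $\mathcal{T}$ if there is $X\in\mathcal{U}$ with $T_X\in\mathcal{N}$. *)

theory Defs
  imports "HOL-Probability.Probability" "HOL-Library.Sublist"
begin

section \<open>The space of ultrafilters on the natural numbers\<close>

definition is_ultrafilter :: "'a filter \<Rightarrow> bool" where
  "is_ultrafilter F \<longleftrightarrow>
     F \<noteq> bot \<and> (\<forall>P. eventually P F \<or> eventually (\<lambda>x. \<not> P x) F)"

text \<open>Principal ultrafilters are included.\<close>

typedef beta_omega = "{F :: nat filter. is_ultrafilter F}"
  morphisms filter_of Abs_beta_omega
proof
  show "principal {0} \<in> {F :: nat filter. is_ultrafilter F}"
    by (simp add: is_ultrafilter_def eventually_principal principal_eq_bot_iff)
qed

definition in_ultrafilter :: "nat set \<Rightarrow> beta_omega \<Rightarrow> bool" (infix "\<in>\<^sub>u" 50) where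
  "U \<in>\<^sub>u x \<longleftrightarrow> eventually (\<lambda>n. n \<in> U) (filter_of x)"

definition basic_clopen :: "nat set \<Rightarrow> beta_omega set" where
  "basic_clopen U = {x. U \<in>\<^sub>u x}"

instantiation beta_omega :: topological_space
begin

definition open_beta_omega :: "beta_omega set \<Rightarrow> bool" where
  "open_beta_omega = generate_topology (range basic_clopen)"

instance
proof
  show "open (UNIV :: beta_omega set)"
    unfolding open_beta_omega_def by (rule generate_topology.UNIV)
  show "open (S \<inter> T)" if "open S" "open T" for S T :: "beta_omega set"
    using that unfolding open_beta_omega_def by (rule generate_topology.Int)
  show "open (\<Union>K)" if "\<forall>S\<in>K. open S" for K :: "beta_omega set set"
    using that unfolding open_beta_omega_def by (blast intro: generate_topology.UN)
qed

end

lemma open_basic_clopen: "open (basic_clopen U)"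
  unfolding open_beta_omega_def by (rule generate_topology.Basis) simp

lemma is_ultrafilter_filter_of: "is_ultrafilter (filter_of x)"
  using filter_of[of x] by simp

lemma in_ultrafilter_Compl: "(- U) \<in>\<^sub>u x \<longleftrightarrow> \<not> U \<in>\<^sub>u x"
proof -
  have "\<not> (U \<in>\<^sub>u x \<and> (- U) \<in>\<^sub>u x)"
  proof
    assume "U \<in>\<^sub>u x \<and> (- U) \<in>\<^sub>u x"
    then have "eventually (\<lambda>n. n \<in> U \<and> n \<in> - U) (filter_of x)"
      unfolding in_ultrafilter_def by (intro eventually_conj) auto
    then have "eventually (\<lambda>n. False) (filter_of x)"
      by (rule eventually_mono) simp
    then show False
      using is_ultrafilter_filter_of[of x]
      by (simp add: is_ultrafilter_def trivial_limit_def)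
  qed
  moreover have "U \<in>\<^sub>u x \<or> (- U) \<in>\<^sub>u x"
    using is_ultrafilter_filter_of[of x]
    by (auto simp: is_ultrafilter_def in_ultrafilter_def)
  ultimately show ?thesis by blast
qed

lemma beta_omega_eqI:
  assumes "\<And>U. U \<in>\<^sub>u x \<longleftrightarrow> U \<in>\<^sub>u y"
  shows "x = y"
proof -
  have "eventually P (filter_of x) \<longleftrightarrow> eventually P (filter_of y)" for P
    using assms[of "{n. P n}"] by (simp add: in_ultrafilter_def)
  then show ?thesis
    by (simp add: filter_eq_iff filter_of_inject[symmetric])
qed

instance beta_omega :: t2_space
proof
  fix x y :: beta_omega
  assume "x \<noteq> y"
  then obtain U where "(U \<in>\<^sub>u x) \<noteq> (U \<in>\<^sub>u y)"
    using beta_omega_eqI by blast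
  then obtain V where V: "V \<in>\<^sub>u x" "\<not> V \<in>\<^sub>u y"
    using in_ultrafilter_Compl by blast
  then have "x \<in> basic_clopen V" "y \<in> basic_clopen (- V)"
    "basic_clopen V \<inter> basic_clopen (- V) = {}"
    by (auto simp: basic_clopen_def in_ultrafilter_Compl)
  then show "\<exists>A B. open A \<and> open B \<and> x \<in> A \<and> y \<in> B \<and> A \<inter> B = {}"
    using open_basic_clopen by blast
qed

section \<open>Radon probability measures\<close>

definition radon_prob :: "'a::t2_space measure \<Rightarrow> bool" where
  "radon_prob M \<longleftrightarrow> prob_space M \<and> sets M = sets borel \<and>
     (\<forall>B\<in>sets borel. emeasure M B = (SUP K\<in>{K. compact K \<and> K \<subseteq> B}. emeasure M K))"

definition nonatomic :: "'a::t2_space measure \<Rightarrow> bool" where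
  "nonatomic M \<longleftrightarrow> (\<forall>x. emeasure M {x} = 0)"

definition msupport :: "'a::t2_space measure \<Rightarrow> 'a set" where
  "msupport M = \<Inter>{F. closed F \<and> emeasure M F = 1}"

section \<open>Trees of subsets of the natural numbers\<close>

definition almost_subset :: "'a set \<Rightarrow> 'a set \<Rightarrow> bool" (infix "\<subseteq>\<^sup>*" 50) where
  "A \<subseteq>\<^sup>* B \<longleftrightarrow> finite (A - B)"

definition almost_eq :: "'a set \<Rightarrow> 'a set \<Rightarrow> bool" (infix "=\<^sup>*" 50) where
  "A =\<^sup>* B \<longleftrightarrow> finite (sym_diff A B)"

text \<open>Finite binary sequences are lists whose head is the value at \<open>0\<close>, so that
  ``\<open>s\<close> extends \<open>t\<close>'' is \<open>prefix t s\<close>.\<close>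

definition subset_tree :: "(bool list \<Rightarrow> nat set) \<Rightarrow> bool" where
  "subset_tree T \<longleftrightarrow>
     (\<forall>s t. prefix t s \<longrightarrow> T s \<subseteq>\<^sup>* T t) \<and>
     (\<forall>k. (\<Union>s\<in>{s. length s = k}. T s) =\<^sup>* UNIV \<and>
          (\<forall>s t. length s = k \<and> length t = k \<and> s \<noteq> t \<longrightarrow> T s \<inter> T t =\<^sup>* {}))"

definition full_subset_tree :: "(bool list \<Rightarrow> nat set) \<Rightarrow> bool" where
  "full_subset_tree T \<longleftrightarrow> subset_tree T \<and> (\<forall>s. infinite (T s))"

definition restrict_seq :: "(nat \<Rightarrow> bool) \<Rightarrow> nat \<Rightarrow> bool list" where
  "restrict_seq x k = map x [0..<k]"

definition tree_branches :: "(bool list \<Rightarrow> nat set) \<Rightarrow> nat set \<Rightarrow> (nat \<Rightarrow> bool) set" where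
  "tree_branches T X = {x. \<forall>k. infinite (T (restrict_seq x k) \<inter> X)}"

definition cantor_measure :: "(nat \<Rightarrow> bool) measure" where
  "cantor_measure = PiM UNIV (\<lambda>_. uniform_count_measure UNIV)"

text \<open>The completion makes every subset of a Borel null set null.\<close>

definition null_ideal :: "(nat \<Rightarrow> bool) set set" where
  "null_ideal = null_sets (completion cantor_measure)"

definition N_diagonalizes :: "beta_omega \<Rightarrow> (bool list \<Rightarrow> nat set) \<Rightarrow> bool" where
  "N_diagonalizes u T \<longleftrightarrow> (\<exists>X. X \<in>\<^sub>u u \<and> tree_branches T X \<in> null_ideal)"

definition avoids_nonatomic_measures :: "beta_omega \<Rightarrow> bool" where
  "avoids_nonatomic_measures u \<longleftrightarrow>
     (\<forall>M. radon_prob M \<and> nonatomic M \<longrightarrow> u \<notin> msupport M)"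

end

theory Submission
  imports Defs
begin

text \<open>
  The map \<open>U \<mapsto> \<mu> [U]\<close> is a finitely additive measure on all subsets of \<open>\<omega>\<close> that vanishes on
  finite sets and, by regularity, admits finite covers of \<open>\<omega>\<close> by sets of arbitrarily small measure.
  Since the power set of \<open>\<omega>\<close> is closed under countable unions, every set can therefore be split into
  two pieces of exactly half its measure. Iterating this gives a full tree with
  \<open>\<mu> [T\<^sub>s] = 2\<^sup>-\<^sup>k\<close> for \<open>s\<close> of length \<open>k\<close>. The branches of \<open>U\<close> are the decreasing intersection
  of the unions of the cylinders \<open>s \<in> 2\<^sup>k\<close> for which \<open>T\<^sub>s \<inter> U\<close> is infinite; as the corresponding \<open>T\<^sub>s\<close>
  cover \<open>U\<close> up to a finite set, each of these unions has Haar measure at least \<open>\<mu> [U]\<close>.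
\<close>

section \<open>Finitely additive measures on a power set\<close>

locale charge =
  fixes m :: "'a set \<Rightarrow> real"
  assumes nonneg: "0 \<le> m A"
    and additive: "A \<inter> B = {} \<Longrightarrow> m (A \<union> B) = m A + m B"
begin

lemma diff: "A \<subseteq> B \<Longrightarrow> m (B - A) = m B - m A"
  using additive[of "B - A" A] by (simp add: Un_absorb2 Diff_disjoint Int_commute)

lemma mono: "A \<subseteq> B \<Longrightarrow> m A \<le> m B"
  using diff[of A B] nonneg[of "B - A"] by simp

lemma subadditive: "m (A \<union> B) \<le> m A + m B"
  using additive[of A "B - A"] mono[of "B - A" B] by auto

lemma empty: "m {} = 0"
  using additive[of "{}" "{}"] by simp

lemma subadditive_UN: "finite I \<Longrightarrow> m (\<Union>i\<in>I. A i) \<le> (\<Sum>i\<in>I. m (A i))"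
proof (induction I rule: finite_induct)
  case (insert i I)
  then show ?case
    using subadditive[of "A i" "\<Union>i\<in>I. A i"] by simp
qed (simp add: empty)

text \<open>Add the traces on \<open>B\<close> of the members of \<open>F\<close> to
  \<open>A\<close> one at a time. Each raises the measure by less than \<open>e\<close>, and since
  they exhaust \<open>B - A\<close> the value \<open>r\<close> is reached at some point; the sets
  just before and just after that are \<open>A'\<close> and \<open>B'\<close>.\<close>

lemma sandwich:
  assumes "finite F" "\<And>P. P \<in> F \<Longrightarrow> m P < e" "0 < e"
    and "A \<subseteq> B" "B - A \<subseteq> \<Union>F" "m A \<le> r" "r \<le> m B"
  shows "\<exists>A' B'. A \<subseteq> A' \<and> A' \<subseteq> B' \<and> B' \<subseteq> B \<and> m A' \<le> r \<and> r \<le> m B' \<and> m B' < m A' + e"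
  using assms
proof (induction F arbitrary: A rule: finite_induct)
  case empty
  then have "A = B" by auto
  with empty.prems show ?case by (intro exI[of _ A] exI[of _ B]) simp
next
  case (insert P F)
  let ?A1 = "A \<union> B \<inter> P"
  show ?case
  proof (cases "r \<le> m ?A1")
    case True
    have "m ?A1 \<le> m A + m (B \<inter> P)" by (rule subadditive)
    also have "m (B \<inter> P) \<le> m P" by (rule mono) auto
    also have "m P < e" using insert.prems by simp
    finally have "m ?A1 < m A + e" by simp
    with True insert.prems show ?thesis
      by (intro exI[of _ A] exI[of _ ?A1]) simp
  next
    case False
    have "\<exists>A' B'. ?A1 \<subseteq> A' \<and> A' \<subseteq> B' \<and> B' \<subseteq> B \<and> m A' \<le> r \<and> r \<le> m B' \<and> m B' < m A' + e"
    proof (rule insert.IH)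
      show "B - ?A1 \<subseteq> \<Union>F" using insert.prems(4) by blast
    qed (use insert.prems False in simp_all)
    then obtain A' B' where "?A1 \<subseteq> A'" "A' \<subseteq> B' \<and> B' \<subseteq> B \<and> m A' \<le> r \<and> r \<le> m B' \<and> m B' < m A' + e"
      by auto
    then show ?thesis by (intro exI[of _ A'] exI[of _ B']) simp
  qed
qed

end

text \<open>Without countable additivity, vanishing on singletons is too weak to allow halving: the
  two-valued charge of a free ultrafilter vanishes on them. Finite covers by small sets are the
  strong form of non-atomicity that does allow it.\<close>

locale nonatomic_charge = charge +
  assumes small_cover: "0 < e \<Longrightarrow> \<exists>F. finite F \<and> \<Union>F = UNIV \<and> (\<forall>P\<in>F. m P < e)"
begin

lemma intermediate_value:
  assumes "0 \<le> r" "r \<le> m C"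
  shows "\<exists>A\<subseteq>C. m A = r"
proof -
  \<comment> \<open>A pair holds an inner and an outer approximation of the set sought. The bound
    \<open>1 / real n\<close> on the gap is waived at \<open>n = 0\<close>, so that
    \<open>({}, C)\<close> can start the recursion.\<close>
  define good where "good n p \<longleftrightarrow> fst p \<subseteq> snd p \<and> snd p \<subseteq> C \<and> m (fst p) \<le> r \<and> r \<le> m (snd p) \<and>
      (n > 0 \<longrightarrow> m (snd p) < m (fst p) + 1 / real n)" for n p
  have "\<exists>f. \<forall>n. good n (f n) \<and> (fst (f n) \<subseteq> fst (f (Suc n)) \<and> snd (f (Suc n)) \<subseteq> snd (f n))"
  proof (rule dependent_nat_choice)
    show "\<exists>p. good 0 p"
      using assms by (intro exI[of _ "({}, C)"]) (simp add: good_def empty)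
    fix p n
    assume p: "good n p"
    obtain F where F: "finite F" "\<Union>F = UNIV" "\<forall>P\<in>F. m P < 1 / real (Suc n)"
      using small_cover[of "1 / real (Suc n)"] by auto
    have "\<exists>A' B'. fst p \<subseteq> A' \<and> A' \<subseteq> B' \<and> B' \<subseteq> snd p \<and> m A' \<le> r \<and> r \<le> m B' \<and>
        m B' < m A' + 1 / real (Suc n)"
    proof (rule sandwich)
      show "finite F" "\<And>P. P \<in> F \<Longrightarrow> m P < 1 / real (Suc n)" "snd p - fst p \<subseteq> \<Union>F"
        using F by auto
    qed (use p in \<open>simp_all add: good_def\<close>)
    then obtain A' B' where "fst p \<subseteq> A'" "A' \<subseteq> B'" "B' \<subseteq> snd p" "m A' \<le> r" "r \<le> m B'"
        "m B' < m A' + 1 / real (Suc n)" by blast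
    moreover have "snd p \<subseteq> C" using p by (simp add: good_def)
    ultimately show "\<exists>q. good (Suc n) q \<and> (fst p \<subseteq> fst q \<and> snd q \<subseteq> snd p)"
      by (intro exI[of _ "(A', B')"]) (simp add: good_def)
  qed
  then obtain f where f: "\<And>n. good n (f n)"
      "\<And>n. fst (f n) \<subseteq> fst (f (Suc n))" "\<And>n. snd (f (Suc n)) \<subseteq> snd (f n)"
    by blast
  define A where "A = (\<Union>n. fst (f n))"
  have inner: "fst (f i) \<subseteq> fst (f j)" if "i \<le> j" for i j
    by (rule lift_Suc_mono_le[of "\<lambda>n. fst (f n)", OF f(2) that])
  have outer: "snd (f j) \<subseteq> snd (f i)" if "i \<le> j" for i j
    by (rule lift_Suc_antimono_le[of "\<lambda>n. snd (f n)", OF f(3) that])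
  have "A \<subseteq> snd (f n)" for n
  proof -
    have "fst (f i) \<subseteq> snd (f n)" for i
    proof -
      have "fst (f i) \<subseteq> fst (f (max i n))" by (rule inner) simp
      also have "\<dots> \<subseteq> snd (f (max i n))" using f(1) by (simp add: good_def)
      also have "\<dots> \<subseteq> snd (f n)" by (rule outer) simp
      finally show ?thesis .
    qed
    then show ?thesis by (auto simp: A_def)
  qed
  then have upper: "m A \<le> m (snd (f n))" for n by (rule mono)
  have lower: "m (fst (f n)) \<le> m A" for n
    by (rule mono) (auto simp: A_def)
  have "\<bar>m A - r\<bar> \<le> 1 / real (Suc n)" for n
    using upper[of "Suc n"] lower[of "Suc n"] f(1)[of "Suc n"]
    unfolding good_def abs_le_iff by linarith
  then have "\<bar>m A - r\<bar> \<le> inverse (real (Suc n))" for n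
    by (simp only: inverse_eq_divide)
  then have "\<not> 0 < \<bar>m A - r\<bar>"
    using reals_Archimedean[of "\<bar>m A - r\<bar>"] by (meson not_le)
  then have "m A = r" by simp
  moreover have "A \<subseteq> C"
    using \<open>A \<subseteq> snd (f 0)\<close> f(1)[of 0] unfolding good_def by blast
  ultimately show ?thesis by blast
qed

section \<open>Dyadic tree of iterated halves\<close>

definition half :: "'a set \<Rightarrow> 'a set" where
  "half C = (SOME A. A \<subseteq> C \<and> m A = m C / 2)"

lemma half: "half C \<subseteq> C" "m (half C) = m C / 2"
proof -
  have "\<exists>A. A \<subseteq> C \<and> m A = m C / 2"
    using intermediate_value[of "m C / 2" C] nonneg[of C] by auto
  from someI_ex[OF this] show "half C \<subseteq> C" "m (half C) = m C / 2"
    unfolding half_def by blast+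
qed

definition child :: "'a set \<Rightarrow> bool \<Rightarrow> 'a set" where
  "child C b = (if b then half C else C - half C)"

lemma child_subset: "child C b \<subseteq> C"
  using half(1) by (auto simp: child_def)

lemma measure_child: "m (child C b) = m C / 2"
  using half[of C] by (simp add: child_def diff)

text \<open>Folding from the left lets the head of the list decide the first split, so that
  extending a sequence at its end refines the set.\<close>

definition halving_tree :: "'a set \<Rightarrow> bool list \<Rightarrow> 'a set" where
  "halving_tree = foldl child"

lemma halving_tree_subset: "halving_tree C s \<subseteq> C"
proof (induction s arbitrary: C)
  case (Cons b s)
  then show ?case
    using child_subset[of C b] by (simp add: halving_tree_def) (meson order_trans)
qed (simp add: halving_tree_def)

text \<open>The part of the tree above \<open>t\<close> is again a halving tree, with root
  \<open>halving_tree C t\<close>, and every node lies in its root.\<close>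

lemma halving_tree_prefix: "prefix t s \<Longrightarrow> halving_tree C s \<subseteq> halving_tree C t"
  using halving_tree_subset by (elim prefixE) (simp add: halving_tree_def)

lemma measure_halving_tree: "m (halving_tree C s) = m C / 2 ^ length s"
  by (induction s arbitrary: C) (simp_all add: halving_tree_def measure_child)

text \<open>At the first entry where the sequences differ, the two nodes pass into complementary
  children of a common set.\<close>

lemma halving_tree_disjoint:
  assumes "length s = length t" "s \<noteq> t"
  shows "halving_tree C s \<inter> halving_tree C t = {}"
  using assms
proof (induction s t arbitrary: C rule: list_induct2)
  case (Cons a s b t)
  show ?case
  proof (cases "a = b")
    case True
    with Cons show ?thesis by (simp add: halving_tree_def)
  next
    case False
    then have "child C a \<inter> child C b = {}" by (auto simp: child_def)
    then show ?thesis
      using halving_tree_subset[of "child C a" s] halving_tree_subset[of "child C b" t]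
      by (auto simp: halving_tree_def)
  qed
qed simp

lemma halving_tree_level: "(\<Union>s\<in>{s. length s = k}. halving_tree C s) = C"
proof (induction k arbitrary: C)
  case (Suc k)
  have "{s :: bool list. length s = Suc k} = (\<Union>b. (#) b ` {s. length s = k})"
    by (auto simp: length_Suc_conv)
  then have "(\<Union>s\<in>{s. length s = Suc k}. halving_tree C s)
      = (\<Union>b. \<Union>s\<in>{s. length s = k}. halving_tree (child C b) s)"
    by (simp add: halving_tree_def)
  also have "\<dots> = (\<Union>b. child C b)" by (simp only: Suc.IH)
  also have "\<dots> = C" using half(1)[of C] by (auto simp: child_def UNIV_bool)
  finally show ?case .
qed (simp add: halving_tree_def)

end

section \<open>Branches of a tree\<close>

lemma finite_lists_length: "finite {s :: bool list. length s = k}"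
  using finite_lists_length_eq[of "UNIV :: bool set" k] by simp

text \<open>A cylinder is a box that fixes the first \<open>k\<close> coordinates, so the product
  measure contributes \<open>k\<close> factors of one half.\<close>

lemma emeasure_cylinder:
  assumes "length s = k"
  shows "{x. restrict_seq x k = s} \<in> sets cantor_measure"
    and "emeasure cantor_measure {x. restrict_seq x k = s} = ennreal (1 / 2 ^ k)"
proof -
  let ?E = "prod_emb UNIV (\<lambda>_::nat. uniform_count_measure (UNIV :: bool set)) {..<k}
    (Pi\<^sub>E {..<k} (\<lambda>i. {s ! i}))"
  have eq: "{x. restrict_seq x k = s} = ?E"
    using assms
    by (simp add: prod_emb_def restrict_seq_def list_eq_iff_nth_eq space_PiM
        space_uniform_count_measure restrict_PiE_iff vimage_def Pi_def lessThan_iff)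
  show "{x. restrict_seq x k = s} \<in> sets cantor_measure"
    unfolding eq cantor_measure_def
    by (rule sets_PiM_I) (simp_all add: sets_uniform_count_measure)
  have "emeasure cantor_measure ?E = (\<Prod>i<k. emeasure (uniform_count_measure UNIV) {s ! i})"
    unfolding cantor_measure_def
    by (intro emeasure_PiM_emb prob_space_uniform_count_measure)
      (simp_all add: sets_uniform_count_measure)
  also have "\<dots> = (\<Prod>i<k. ennreal (1 / 2))"
    by (intro prod.cong) (simp_all add: emeasure_uniform_count_measure)
  also have "\<dots> = ennreal (1 / 2 ^ k)"
    unfolding prod_constant card_lessThan by (subst ennreal_power) (simp_all add: power_one_over)
  finally show "emeasure cantor_measure {x. restrict_seq x k = s} = ennreal (1 / 2 ^ k)"
    unfolding eq .
qed

lemma prob_space_cantor_measure: "prob_space cantor_measure"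
  unfolding cantor_measure_def
  by (intro prob_space_PiM prob_space_uniform_count_measure) auto

lemma restrict_seq_level:
  fixes S :: "bool list set"
  assumes "S \<subseteq> {s. length s = k}"
  shows "{x. restrict_seq x k \<in> S} \<in> sets cantor_measure"
    and "emeasure cantor_measure {x. restrict_seq x k \<in> S} = ennreal (card S / 2 ^ k)"
proof -
  have fin: "finite S" using assms finite_lists_length finite_subset by blast
  have eq: "{x. restrict_seq x k \<in> S} = (\<Union>s\<in>S. {x. restrict_seq x k = s})" by auto
  have meas: "{x. restrict_seq x k = s} \<in> sets cantor_measure" if "s \<in> S" for s
    using that assms by (intro emeasure_cylinder) auto
  show "{x. restrict_seq x k \<in> S} \<in> sets cantor_measure"
    unfolding eq using fin meas by (intro sets.finite_UN) auto
  have "emeasure cantor_measure {x. restrict_seq x k \<in> S}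
      = (\<Sum>s\<in>S. emeasure cantor_measure {x. restrict_seq x k = s})"
    unfolding eq using fin meas
    by (intro sum_emeasure[symmetric]) (auto simp: disjoint_family_on_def)
  also have "\<dots> = (\<Sum>s\<in>S. ennreal (1 / 2 ^ k))"
    using assms by (intro sum.cong emeasure_cylinder) auto
  also have "\<dots> = ennreal (card S / 2 ^ k)"
    by (subst sum_ennreal) simp_all
  finally show "emeasure cantor_measure {x. restrict_seq x k \<in> S} = ennreal (card S / 2 ^ k)" .
qed

text \<open>Applied in contrapositive form: a null set of branches forces \<open>m U = 0\<close>.
  Measurability is part of the conclusion because \<open>null_ideal\<close> refers to the completed
  measure.\<close>

lemma tree_branches_measure_ge:
  fixes m :: "nat set \<Rightarrow> real"
  assumes "charge m" and fin0: "\<And>A. finite A \<Longrightarrow> m A = 0"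
    and T: "subset_tree T" and mT: "\<And>s. m (T s) = 1 / 2 ^ length s"
  shows "tree_branches T U \<in> sets cantor_measure"
    and "ennreal (m U) \<le> emeasure cantor_measure (tree_branches T U)"
proof -
  interpret charge m by fact
  interpret prob_space cantor_measure by (rule prob_space_cantor_measure)
  \<comment> \<open>\<open>S k\<close> collects the nodes of level \<open>k\<close> that a branch of
    \<open>U\<close> may visit, and \<open>D k\<close> the sequences passing through one of
    them.\<close>
  define S where "S k = {s. length s = k \<and> infinite (T s \<inter> U)}" for k
  define D where "D k = {x. restrict_seq x k \<in> S k}" for k
  have sub: "S k \<subseteq> {s. length s = k}" for k by (auto simp: S_def)
  have D: "D k \<in> sets cantor_measure"
    and emeasure_D: "emeasure cantor_measure (D k) = ennreal (card (S k) / 2 ^ k)" for k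
    using restrict_seq_level[OF sub] by (simp_all add: D_def)
  have branches: "tree_branches T U = (\<Inter>k. D k)"
    by (auto simp: tree_branches_def D_def S_def restrict_seq_def)
  show "tree_branches T U \<in> sets cantor_measure"
    unfolding branches using D by (intro sets.countable_INT) auto
  \<comment> \<open>Almost inclusion carries an infinite trace on \<open>U\<close> from a node down
    to its predecessor. Hence the \<open>D k\<close> decrease, and continuity from above
    applies.\<close>
  have "decseq D"
  proof (rule decseq_SucI, rule subsetI)
    fix k x
    assume "x \<in> D (Suc k)"
    then have inf: "infinite (T (restrict_seq x (Suc k)) \<inter> U)" by (simp add: D_def S_def)
    have "prefix (restrict_seq x k) (restrict_seq x (Suc k))" by (simp add: restrict_seq_def)
    then have "finite (T (restrict_seq x (Suc k)) - T (restrict_seq x k))"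
      using T by (simp add: subset_tree_def almost_subset_def)
    moreover have "T (restrict_seq x (Suc k)) \<inter> U
        \<subseteq> (T (restrict_seq x (Suc k)) - T (restrict_seq x k)) \<union> T (restrict_seq x k) \<inter> U" by auto
    ultimately have "infinite (T (restrict_seq x k) \<inter> U)"
      using inf by (meson finite_UnI finite_subset)
    then show "x \<in> D k" by (simp add: D_def S_def restrict_seq_def)
  qed
  then have lim: "emeasure cantor_measure (\<Inter>k. D k) = (INF k. emeasure cantor_measure (D k))"
    using D by (intro INF_emeasure_decseq[symmetric]) (auto simp: emeasure_eq_measure)
  have "m U \<le> card (S k) / 2 ^ k" for k
  proof -
    \<comment> \<open>\<open>?R\<close> contains all of \<open>U\<close> that the nodes in
      \<open>S k\<close> can miss: the finitely many points outside level \<open>k\<close>, and the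
      finite traces of the other nodes on \<open>U\<close>.\<close>
    let ?R = "- (\<Union>s\<in>{s. length s = k}. T s) \<union> (\<Union>s\<in>{s. length s = k} - S k. T s \<inter> U)"
    have "finite (- (\<Union>s\<in>{s. length s = k}. T s))"
      using T by (simp add: subset_tree_def almost_eq_def Compl_eq_Diff_UNIV)
    moreover have "finite (\<Union>s\<in>{s. length s = k} - S k. T s \<inter> U)"
      using finite_lists_length by (intro finite_UN_I) (auto simp: S_def)
    ultimately have R: "finite ?R" by simp
    have "U \<subseteq> ?R \<union> (\<Union>s\<in>S k. T s)" by (auto simp: S_def)
    then have "m U \<le> m (?R \<union> (\<Union>s\<in>S k. T s))" by (rule mono)
    also have "\<dots> \<le> m ?R + m (\<Union>s\<in>S k. T s)" by (rule subadditive)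
    also have "m ?R = 0" by (rule fin0[OF R])
    also have "m (\<Union>s\<in>S k. T s) \<le> (\<Sum>s\<in>S k. m (T s))"
      by (rule subadditive_UN) (rule finite_subset[OF sub finite_lists_length])
    also have "\<dots> = (\<Sum>s\<in>S k. 1 / 2 ^ k)" by (intro sum.cong) (auto simp: mT S_def)
    finally show ?thesis by simp
  qed
  then show "ennreal (m U) \<le> emeasure cantor_measure (tree_branches T U)"
    unfolding branches lim emeasure_D by (intro INF_greatest ennreal_leI)
qed

section \<open>Non-atomic measures on the space of ultrafilters\<close>

lemma in_ultrafilter_mono: "A \<in>\<^sub>u x \<Longrightarrow> A \<subseteq> B \<Longrightarrow> B \<in>\<^sub>u x"
  unfolding in_ultrafilter_def by (erule eventually_mono) blast

lemma basic_clopen_Un: "basic_clopen (A \<union> B) = basic_clopen A \<union> basic_clopen B"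
proof -
  have "A \<in>\<^sub>u x" if "A \<union> B \<in>\<^sub>u x" "- B \<in>\<^sub>u x" for x
    using that unfolding in_ultrafilter_def by eventually_elim simp
  then have "A \<union> B \<in>\<^sub>u x \<longleftrightarrow> A \<in>\<^sub>u x \<or> B \<in>\<^sub>u x" for x
    using in_ultrafilter_mono[of A x "A \<union> B"] in_ultrafilter_mono[of B x "A \<union> B"]
    by (metis in_ultrafilter_Compl Un_upper1 Un_upper2)
  then show ?thesis unfolding basic_clopen_def by blast
qed

lemma basic_clopen_Compl: "basic_clopen (- A) = - basic_clopen A"
  by (auto simp: basic_clopen_def in_ultrafilter_Compl)

lemma basic_clopen_UNIV: "basic_clopen UNIV = UNIV"
  by (simp add: basic_clopen_def in_ultrafilter_def)

lemma basic_clopen_empty: "basic_clopen {} = {}"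
  using basic_clopen_Compl[of UNIV] by (simp add: basic_clopen_UNIV)

lemma basic_clopen_Int: "basic_clopen (A \<inter> B) = basic_clopen A \<inter> basic_clopen B"
proof -
  have "basic_clopen (- (A \<inter> B)) = - basic_clopen A \<union> - basic_clopen B"
    by (simp only: Compl_Int basic_clopen_Un basic_clopen_Compl)
  then show ?thesis unfolding basic_clopen_Compl by blast
qed

lemma basic_clopen_UN: "finite I \<Longrightarrow> basic_clopen (\<Union>i\<in>I. A i) = (\<Union>i\<in>I. basic_clopen (A i))"
  by (induction I rule: finite_induct) (simp_all add: basic_clopen_empty basic_clopen_Un)

lemma closed_basic_clopen: "closed (basic_clopen A)"
  using open_basic_clopen[of "- A"] by (simp add: closed_def basic_clopen_Compl)

text \<open>The generating sets are closed under finite intersections, so the subbase is a base; the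
  proof is an induction on the generation of \<open>W\<close>.\<close>

lemma open_contains_basic_clopen:
  assumes "open W" "x \<in> W"
  shows "\<exists>V. x \<in> basic_clopen V \<and> basic_clopen V \<subseteq> W"
proof -
  have "generate_topology (range basic_clopen) W"
    using assms(1) by (simp add: open_beta_omega_def)
  then show ?thesis using assms(2)
  proof (induction rule: generate_topology.induct)
    case UNIV
    then show ?case using basic_clopen_UNIV by blast
  next
    case (Int a b)
    then obtain V V' where "x \<in> basic_clopen V" "basic_clopen V \<subseteq> a"
      "x \<in> basic_clopen V'" "basic_clopen V' \<subseteq> b" by blast
    then show ?case by (intro exI[of _ "V \<inter> V'"]) (auto simp: basic_clopen_Int)
  next
    case (UN K)
    then obtain k where "k \<in> K" "x \<in> k" by blast
    with UN.IH obtain V where "x \<in> basic_clopen V" "basic_clopen V \<subseteq> k" by blast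
    with \<open>k \<in> K\<close> show ?case by blast
  next
    case (Basis W)
    then obtain V where "W = basic_clopen V" by blast
    with Basis.prems show ?case by blast
  qed
qed

text \<open>An ultrafilter containing \<open>{n}\<close> is principal: it contains exactly the sets
  that have \<open>n\<close> as an element. Hence there is at most one.\<close>

lemma basic_clopen_singleton:
  assumes "x \<in> basic_clopen {n}"
  shows "basic_clopen {n} = {x}"
proof -
  have *: "U \<in>\<^sub>u y \<longleftrightarrow> n \<in> U" if "y \<in> basic_clopen {n}" for y U
  proof (cases "n \<in> U")
    case True
    then show ?thesis
      using that in_ultrafilter_mono[of "{n}" y U] by (simp add: basic_clopen_def)
  next
    case False
    then have "- U \<in>\<^sub>u y"
      using that in_ultrafilter_mono[of "{n}" y "- U"] by (simp add: basic_clopen_def)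
    with False show ?thesis by (simp add: in_ultrafilter_Compl)
  qed
  have "y = x" if "y \<in> basic_clopen {n}" for y
    using *[OF that] *[OF assms] by (intro beta_omega_eqI) simp
  with assms show ?thesis by blast
qed

section \<open>From a Radon measure to a charge on sets of naturals\<close>

locale nonatomic_radon =
  fixes \<mu> :: "beta_omega measure"
  assumes radon: "radon_prob \<mu>" and nonatomic: "nonatomic \<mu>"
begin

sublocale prob_space \<mu>
  using radon unfolding radon_prob_def by (elim conjE)

lemma sets_eq: "sets \<mu> = sets borel"
  using radon unfolding radon_prob_def by (elim conjE)

lemma space_eq: "space \<mu> = UNIV"
  using sets_eq_imp_space_eq[OF sets_eq] by simp

lemma sets_Compl: "B \<in> sets \<mu> \<Longrightarrow> - B \<in> sets \<mu>"
  using sets.compl_sets[of B \<mu>] by (simp add: space_eq Compl_eq_Diff_UNIV)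

lemma prob_Compl: "B \<in> sets \<mu> \<Longrightarrow> prob (- B) = 1 - prob B"
  using prob_compl[of B] by (simp add: space_eq Compl_eq_Diff_UNIV)

lemma basic_clopen_sets [measurable]: "basic_clopen A \<in> sets \<mu>"
  unfolding sets_eq by (rule borel_open[OF open_basic_clopen])

lemma compact_sets: "compact K \<Longrightarrow> K \<in> sets \<mu>"
  by (simp add: sets_eq compact_imp_closed borel_closed)

lemma prob_singleton: "prob {x} = 0"
  using nonatomic by (simp add: nonatomic_def measure_def)

lemma inner_regular:
  assumes "B \<in> sets \<mu>" "prob B = 1" "0 < e"
  shows "\<exists>K. compact K \<and> K \<subseteq> B \<and> prob (- K) < e"
proof -
  \<comment> \<open>If \<open>e > 1\<close>, then \<open>ennreal (1 - e)\<close> is truncated to 0,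
    which is still below \<open>prob B = 1\<close>.\<close>
  have "ennreal (1 - e) < emeasure \<mu> B"
    unfolding emeasure_eq_measure using assms by (intro ennreal_lessI) simp_all
  also have "\<dots> = (SUP K\<in>{K. compact K \<and> K \<subseteq> B}. emeasure \<mu> K)"
    using radon assms(1) unfolding radon_prob_def sets_eq by (elim conjE bspec)
  finally obtain K where K: "compact K" "K \<subseteq> B" "ennreal (1 - e) < emeasure \<mu> K"
    unfolding less_SUP_iff by blast
  then have "1 - e < prob K"
    using ennreal_leI[of "prob K" "1 - e"] unfolding emeasure_eq_measure by (meson not_le)
  then have "prob (- K) < e"
    by (simp add: prob_Compl compact_sets K(1))
  with K show ?thesis by blast
qed

text \<open>The complement of the null set \<open>{x}\<close> contains a compact \<open>K\<close> of
  nearly full measure. Compact sets are closed, so \<open>- K\<close> is an open neighbourhood of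
  \<open>x\<close> of small measure.\<close>

lemma small_neighbourhood:
  assumes "0 < e"
  shows "\<exists>V. x \<in> basic_clopen V \<and> prob (basic_clopen V) < e"
proof -
  have x: "{x} \<in> sets \<mu>" by (simp add: compact_sets)
  have "prob (- {x}) = 1"
    by (simp add: prob_Compl[OF x] prob_singleton)
  moreover have "- {x} \<in> sets \<mu>" by (rule sets_Compl[OF x])
  ultimately obtain K where K: "compact K" "K \<subseteq> - {x}" "prob (- K) < e"
    using inner_regular assms by blast
  obtain V where V: "x \<in> basic_clopen V" "basic_clopen V \<subseteq> - K"
    using open_contains_basic_clopen[of "- K" x] K compact_imp_closed by (auto simp: open_Compl)
  have "- K \<in> sets \<mu>"
    by (rule sets_Compl[OF compact_sets[OF K(1)]])
  then have "prob (basic_clopen V) \<le> prob (- K)"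
    using V by (intro finite_measure_mono) auto
  with V K show ?thesis by auto
qed

sublocale charge: nonatomic_charge "\<lambda>A. prob (basic_clopen A)"
proof
  fix A B :: "nat set"
  show "0 \<le> prob (basic_clopen A)" by simp
  assume "A \<inter> B = {}"
  then have "basic_clopen A \<inter> basic_clopen B = {}"
    using basic_clopen_Int[of A B] by (simp add: basic_clopen_empty)
  then show "prob (basic_clopen (A \<union> B)) = prob (basic_clopen A) + prob (basic_clopen B)"
    by (simp add: basic_clopen_Un finite_measure_Union)
next
  fix e :: real
  assume e: "0 < e"
  \<comment> \<open>Finitely many small neighbourhoods cover this compact set. The remaining set of
    naturals \<open>W\<close> has \<open>basic_clopen W\<close> inside \<open>- K\<close>, so it is
    small as well and completes the cover.\<close>
  obtain K where K: "compact K" "prob (- K) < e"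
    using inner_regular[of UNIV] e prob_space by (auto simp: space_eq sets_eq)
  obtain V where V: "\<And>x. x \<in> basic_clopen (V x)" "\<And>x. prob (basic_clopen (V x)) < e"
    using small_neighbourhood[OF e] by metis
  obtain X where X: "finite X" "K \<subseteq> (\<Union>x\<in>X. basic_clopen (V x))"
  proof (rule compactE_image[OF K(1)])
    show "open (basic_clopen (V x))" for x by (rule open_basic_clopen)
    show "K \<subseteq> (\<Union>x\<in>K. basic_clopen (V x))" using V(1) by blast
  qed
  define W where "W = - (\<Union>x\<in>X. V x)"
  have "basic_clopen W \<subseteq> - K"
    using X(2) unfolding W_def basic_clopen_Compl basic_clopen_UN[OF X(1)] by blast
  moreover have "- K \<in> sets \<mu>"
    by (rule sets_Compl[OF compact_sets[OF K(1)]])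
  ultimately have "prob (basic_clopen W) \<le> prob (- K)"
    by (intro finite_measure_mono) auto
  with K have "prob (basic_clopen W) < e" by simp
  then show "\<exists>F. finite F \<and> \<Union>F = UNIV \<and> (\<forall>P\<in>F. prob (basic_clopen P) < e)"
    using X V by (intro exI[of _ "insert W (V ` X)"]) (auto simp: W_def)
qed

text \<open>For a single \<open>n\<close> the clopen set has at most one point, which is null by
  non-atomicity; subadditivity does the rest.\<close>

lemma measure_finite_set: "finite A \<Longrightarrow> prob (basic_clopen A) = 0"
proof (induction A rule: finite_induct)
  case empty
  show ?case by (rule charge.empty)
next
  case (insert n A)
  have "prob (basic_clopen {n}) = 0"
  proof (cases "basic_clopen {n} = {}")
    case False
    then obtain x where "basic_clopen {n} = {x}"
      using basic_clopen_singleton[of _ n] by (metis all_not_in_conv)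
    then show ?thesis by (simp add: prob_singleton)
  qed simp
  then show ?case
    using charge.subadditive[of "{n}" A] insert.IH by (simp add: measure_le_0_iff)
qed

lemma measure_halving: "prob (basic_clopen (charge.halving_tree UNIV s)) = 1 / 2 ^ length s"
  using prob_space by (simp add: charge.measure_halving_tree basic_clopen_UNIV space_eq)

lemma full_subset_tree_halving: "full_subset_tree (charge.halving_tree UNIV)"
  unfolding full_subset_tree_def subset_tree_def
proof (intro conjI allI impI)
  fix s
  show "infinite (charge.halving_tree UNIV s)"
    \<comment> \<open>Finite sets are null, while each node has positive measure.\<close>
    using measure_finite_set measure_halving[of s] by fastforce
next
  fix s t :: "bool list" assume "prefix t s"
  from charge.halving_tree_prefix[OF this]
  show "charge.halving_tree UNIV s \<subseteq>\<^sup>* charge.halving_tree UNIV t"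
    by (simp add: almost_subset_def Diff_eq_empty_iff[THEN iffD2])
next
  fix k
  show "(\<Union>s\<in>{s. length s = k}. charge.halving_tree UNIV s) =\<^sup>* UNIV"
    by (simp add: charge.halving_tree_level almost_eq_def)
next
  fix k and s t :: "bool list"
  assume "length s = k \<and> length t = k \<and> s \<noteq> t"
  then show "charge.halving_tree UNIV s \<inter> charge.halving_tree UNIV t =\<^sup>* {}"
    by (simp add: charge.halving_tree_disjoint almost_eq_def)
qed

lemma null_branches:
  assumes "tree_branches (charge.halving_tree UNIV) U \<in> null_ideal"
  shows "emeasure \<mu> (basic_clopen U) = 0"
proof -
  have tree: "subset_tree (charge.halving_tree UNIV)"
    using full_subset_tree_halving by (simp add: full_subset_tree_def)
  note ge = tree_branches_measure_ge[OF charge.charge_axioms measure_finite_set tree measure_halving]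
  \<comment> \<open>As the set of branches is measurable already before completion, being null for
    the completion means being null for \<open>cantor_measure\<close>.\<close>
  have "emeasure cantor_measure (tree_branches (charge.halving_tree UNIV) U) = 0"
    using assms ge(1)[of U] by (simp add: null_ideal_def null_sets_def)
  then show ?thesis using ge(2)[of U] by (simp add: emeasure_eq_measure)
qed

end

theorem corollary6p5:
  "(\<forall>\<mu> :: beta_omega measure. radon_prob \<mu> \<and> nonatomic \<mu> \<longrightarrow>
      (\<exists>T. subset_tree T \<and>
           (\<forall>U. tree_branches T U \<in> null_ideal \<longrightarrow> emeasure \<mu> (basic_clopen U) = 0))) \<and>
   (\<forall>u :: beta_omega. (\<forall>T. full_subset_tree T \<longrightarrow> N_diagonalizes u T) \<longrightarrow>
      avoids_nonatomic_measures u)"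
proof -
  \<comment> \<open>Fullness is kept here because the second claim assumes diagonalization of full
    trees only.\<close>
  have tree: "\<exists>T. full_subset_tree T \<and>
      (\<forall>U. tree_branches T U \<in> null_ideal \<longrightarrow> emeasure \<mu> (basic_clopen U) = 0)"
    if "radon_prob \<mu>" "nonatomic \<mu>" for \<mu>
  proof -
    interpret nonatomic_radon \<mu> using that by unfold_locales
    show ?thesis using full_subset_tree_halving null_branches by blast
  qed
  have "u \<notin> msupport \<mu>"
    if diag: "\<forall>T. full_subset_tree T \<longrightarrow> N_diagonalizes u T" and \<mu>: "radon_prob \<mu>" "nonatomic \<mu>"
    for u \<mu>
  proof
    assume supp: "u \<in> msupport \<mu>"
    interpret nonatomic_radon \<mu> using \<mu> by unfold_locales
    obtain X where X: "X \<in>\<^sub>u u" "emeasure \<mu> (basic_clopen X) = 0"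
      using tree[OF \<mu>] diag unfolding N_diagonalizes_def by blast
    \<comment> \<open>This closed set of measure 1 contains the support, yet it omits
      \<open>u\<close>, since \<open>X\<close> belongs to \<open>u\<close>.\<close>
    have "emeasure \<mu> (basic_clopen (- X)) = 1"
      using X(2) by (simp add: basic_clopen_Compl prob_Compl emeasure_eq_measure)
    then have "u \<in> basic_clopen (- X)"
      using supp closed_basic_clopen unfolding msupport_def by blast
    with X(1) show False by (simp add: basic_clopen_def in_ultrafilter_Compl)
  qed
  with tree show ?thesis
    unfolding avoids_nonatomic_measures_def full_subset_tree_def by blast
qed

end
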